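(* For every integer $n \ge 1$, let $f(n)$ be the maximum, over all cyclic permutations $\pi$ of order $n$, of the minimum number of adjacent swaps needed to transform $\pi$ into the trivial cyclic permutation $u=(1,2,\ldots,n)$. Then \[ f(n) = \left\lfloor \frac{(n-1)^2}{4} \right\rfloor. \]
   Context: A cyclic permutation of order $n$ is a bijective labeling of the vertices of a cycle of length $n$ by the elements of $[n]=\{1,\ldots,n\}$, where two labelings that differ by a rotation of the cycle (a cyclic shift) are considered the same; reflections are not identified. An adjacent swap transforms a cyclic permutation into the one obtained by exchanging the labels of two vertices that are adjacent along the cycle. The trivial cyclic permutation $u=(1,2,\ldots,n)$ is the labeling in which the labels $1,2,\ldots,n$ appear consecutively around the cycle in this order. Equivalently, $f(n)$ is the diameter of the graph whose vertices are the cyclic permutations of order $n$, two being adjacent iff one is obtained from the other by a single adjacent swap. *)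

theory Defs
  imports Complex_Main "HOL-Library.Extended_Nat"
begin

text \<open>
  A labeling of the \<open>n\<close>-cycle is a list \<open>xs\<close> of length \<open>n\<close>; the vertices of the cycle are the
  positions \<open>0, \<dots>, n - 1\<close>, with \<open>i\<close> followed by \<open>(i + 1) mod n\<close>.
\<close>

definition labelings :: "nat \<Rightarrow> nat list set" where
  "labelings n = {xs. distinct xs \<and> set xs = {1..n}}"

definition rotation_rel :: "nat \<Rightarrow> (nat list \<times> nat list) set" where
  "rotation_rel n = {(xs, ys). xs \<in> labelings n \<and> (\<exists>k. ys = rotate k xs)}"

definition cyclic_perms :: "nat \<Rightarrow> nat list set set" where
  "cyclic_perms n = labelings n // rotation_rel n"

definition trivial_cyclic_perm :: "nat \<Rightarrow> nat list set" where
  "trivial_cyclic_perm n = rotation_rel n `` {[1..<Suc n]}"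

definition swap_labels :: "nat list \<Rightarrow> nat \<Rightarrow> nat \<Rightarrow> nat list" where
  "swap_labels xs i j = xs[i := xs ! j, j := xs ! i]"

text \<open>
  The condition \<open>i \<noteq> j\<close> only matters for \<open>n = 1\<close>, where there are no two adjacent vertices.
  For \<open>n = 2\<close> the swap exists but leads back to the same cyclic permutation.
\<close>

definition adjacent_swap :: "nat \<Rightarrow> (nat list set \<times> nat list set) set" where
  "adjacent_swap n = {(P, Q). P \<in> cyclic_perms n \<and> Q \<in> cyclic_perms n \<and>
     (\<exists>xs\<in>P. \<exists>i<n. \<exists>j<n. i \<noteq> j \<and> j = (i + 1) mod n \<and> swap_labels xs i j \<in> Q)}"

text \<open>
  The value is \<open>\<infinity>\<close>, the infimum of the empty set, if \<open>Q\<close> cannot be reached from \<open>P\<close>.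
\<close>

definition swap_distance :: "nat \<Rightarrow> nat list set \<Rightarrow> nat list set \<Rightarrow> enat" where
  "swap_distance n P Q = (INF k\<in>{k. (P, Q) \<in> adjacent_swap n ^^ k}. enat k)"

definition max_swap_distance :: "nat \<Rightarrow> enat" where
  "max_swap_distance n = Max ((\<lambda>P. swap_distance n P (trivial_cyclic_perm n)) ` cyclic_perms n)"

end

theory Submission
  imports Defs
begin

text \<open>
  Lower bound: a rotation changes the relative order of exactly the pairs separated by some cut of
  the label set, and an adjacent swap changes, up to such a cut, the order of a single pair. Sorting
  the reversal must change all pairs up to a cut, so all pairs inside the two parts are swapped, and
  two cliques on \<open>n\<close> vertices in total have at least \<open>\<lfloor>(n - 1)\<^sup>2 / 4\<rfloor>\<close> edges.

  Upper bound: unroll the cycle and choose for every label \<open>a\<close> an integer displacement that takes it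
  to its target. Bubble sort then needs as many swaps as there are forced crossings. Restrict the
  displacements to a window \<open>{t..<t + n}\<close> and average over \<open>t\<close>: the pair \<open>{a, b}\<close> contributes
  \<open>\<bar>p - q\<bar> / n\<close>, where \<open>p\<close> and \<open>q\<close> are the distances from \<open>b\<close> to \<open>a\<close> along the given and along the
  trivial cycle. For fixed \<open>a\<close>, both \<open>p\<close> and \<open>q\<close> run through \<open>1, \<dots>, n - 1\<close>, and
  \<open>2 \<bar>p - q\<bar> \<le> \<bar>2 p - n\<bar> + \<bar>2 q - n\<bar>\<close> bounds the average by \<open>\<lfloor>(n - 1)\<^sup>2 / 4\<rfloor>\<close>.
\<close>

section \<open>Labelings and their rotations\<close>

lemma length_labeling: "xs \<in> labelings n \<Longrightarrow> length xs = n"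
  unfolding labelings_def using distinct_card by fastforce

lemma nth_labeling: "xs \<in> labelings n \<Longrightarrow> i < n \<Longrightarrow> xs ! i \<in> {1..n}"
  using length_labeling[of xs n] nth_mem[of i xs] unfolding labelings_def by simp

lemma nth_labeling_eq_iff:
  "xs \<in> labelings n \<Longrightarrow> i < n \<Longrightarrow> j < n \<Longrightarrow> xs ! i = xs ! j \<longleftrightarrow> i = j"
  using length_labeling[of xs n] by (simp add: labelings_def nth_eq_iff_index_eq)

lemma labeling_nthE:
  assumes "xs \<in> labelings n" "a \<in> {1..n}"
  obtains i where "i < n" "xs ! i = a"
  using assms length_labeling[of xs n] in_set_conv_nth[of a xs] by (auto simp: labelings_def)

lemma finite_labelings: "finite (labelings n)"
  by (rule finite_subset[OF _ finite_lists_length_eq[of "{1..n}" n]])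
    (auto simp: length_labeling, auto simp: labelings_def)

lemma rotate_labeling: "xs \<in> labelings n \<Longrightarrow> rotate k xs \<in> labelings n"
  by (simp add: labelings_def)

lemma swap_labeling:
  assumes "xs \<in> labelings n" "i < n" "j < n"
  shows "swap_labels xs i j \<in> labelings n"
  using assms length_labeling[of xs n]
  by (simp add: labelings_def swap_labels_def set_swap distinct_swap)

lemma nth_swap_labels:
  "length xs = n \<Longrightarrow> i < n \<Longrightarrow> j < n \<Longrightarrow> l < n \<Longrightarrow>
    swap_labels xs i j ! l = (if l = j then xs ! i else if l = i then xs ! j else xs ! l)"
  by (simp add: swap_labels_def nth_list_update)

lemma trivial_labeling: "[1..<Suc n] \<in> labelings n"
  by (auto simp: labelings_def)

lemma reversed_labeling: "rev [1..<Suc n] \<in> labelings n"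
  by (auto simp: labelings_def)

lemma equiv_rotation_rel: "equiv (labelings n) (rotation_rel n)"
proof (rule equivI)
  show "rotation_rel n \<subseteq> labelings n \<times> labelings n"
    by (auto simp: rotation_rel_def rotate_labeling)
  show "refl_on (labelings n) (rotation_rel n)"
    by (auto simp: rotation_rel_def refl_on_def rotate_labeling intro: exI[of _ 0])
  show "sym (rotation_rel n)"
  proof (rule symI)
    fix xs ys assume "(xs, ys) \<in> rotation_rel n"
    then obtain k where xs: "xs \<in> labelings n" and ys: "ys = rotate k xs"
      by (auto simp: rotation_rel_def)
    have "rotate (n - k mod n) ys = xs"
    proof (cases "n = 0")
      case True
      then show ?thesis using xs ys length_labeling[OF xs] by simp
    next
      case False
      have "ys = rotate (k mod n) xs"
        using ys rotate_conv_mod[of k xs] length_labeling[OF xs] by simp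
      then have "rotate (n - k mod n) ys = rotate (n - k mod n + k mod n) xs"
        by (simp add: rotate_rotate)
      also have "\<dots> = xs"
        using False length_labeling[OF xs] by (simp add: rotate_id)
      finally show ?thesis .
    qed
    then show "(ys, xs) \<in> rotation_rel n"
      using rotate_labeling[OF xs] ys by (auto simp: rotation_rel_def intro!: exI[of _ "n - k mod n"])
  qed
  show "trans (rotation_rel n)"
    by (rule transI) (auto simp: rotation_rel_def rotate_rotate)
qed

lemma rotation_class_in_cyclic_perms:
  "xs \<in> labelings n \<Longrightarrow> rotation_rel n `` {xs} \<in> cyclic_perms n"
  unfolding cyclic_perms_def by (rule quotientI)

lemma in_rotation_class: "xs \<in> labelings n \<Longrightarrow> xs \<in> rotation_rel n `` {xs}"
  by (rule equiv_class_self[OF equiv_rotation_rel])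

lemma cyclic_perm_subset: "P \<in> cyclic_perms n \<Longrightarrow> P \<subseteq> labelings n"
  unfolding cyclic_perms_def by (rule in_quotient_imp_subset[OF equiv_rotation_rel])

lemma cyclic_perm_rotate:
  assumes "P \<in> cyclic_perms n" "xs \<in> P" "ys \<in> P"
  obtains k where "ys = rotate k xs"
  using in_quotient_imp_in_rel[OF equiv_rotation_rel, of P n xs ys] assms
  by (auto simp: cyclic_perms_def rotation_rel_def)


section \<open>The reversal is far from the trivial cyclic permutation\<close>

text \<open>Only the values at labels occurring in \<open>xs\<close> carry information; elsewhere
  \<open>inv_into\<close> is unspecified.\<close>

definition label_pos :: "nat list \<Rightarrow> nat \<Rightarrow> nat" where
  "label_pos xs = inv_into {..<length xs} ((!) xs)"

lemma label_pos_nth: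
  assumes "xs \<in> labelings n" "i < n"
  shows "label_pos xs (xs ! i) = i"
proof -
  have "inj_on ((!) xs) {..<length xs}"
    using assms by (intro inj_on_nth) (auto simp: labelings_def)
  then show ?thesis
    unfolding label_pos_def using assms length_labeling[of xs n] by (simp add: inv_into_f_f)
qed

text \<open>
  A rotation that moves the labels in \<open>S\<close> across the end of the list changes the relative order of
  exactly the pairs separated by \<open>S\<close>. Hence, up to such a cut (the coloring \<open>s\<close>), only the pairs in
  \<open>G\<close> that were actually swapped change their relative order.
\<close>

definition order_change :: "nat \<Rightarrow> nat \<Rightarrow> nat list \<Rightarrow> nat list \<Rightarrow> bool" where
  "order_change n k xs ys \<longleftrightarrow> (\<exists>G s. finite G \<and> card G \<le> k \<and>
     (\<forall>a\<in>{1..n}. \<forall>b\<in>{1..n}. a \<noteq> b \<longrightarrow>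
       ((label_pos xs a < label_pos xs b) = (label_pos ys a < label_pos ys b)) =
       ((s a = (s b :: bool)) = ({a, b} \<notin> G))))"

lemma order_change_refl: "order_change n 0 xs xs"
  unfolding order_change_def by (intro exI[of _ "{}"] exI[of _ "\<lambda>_. True"]) auto

text \<open>Reversing the order of a pair twice restores it, so changes combine by exclusive or: the
  swapped pairs by symmetric difference, the cuts by comparing the two colorings through
  \<open>s a = t a\<close>. A symmetric difference is contained in the union, which bounds its
  size.\<close>

lemma order_change_trans:
  assumes "order_change n k xs ys" "order_change n l ys zs"
  shows "order_change n (k + l) xs zs"
proof -
  from assms(1) obtain G s where G: "finite G" "card G \<le> k" and Gs: "\<And>a b. a\<in>{1..n} \<Longrightarrow> b\<in>{1..n} \<Longrightarrow> a \<noteq> b \<Longrightarrow>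
       ((label_pos xs a < label_pos xs b) = (label_pos ys a < label_pos ys b)) =
       ((s a = (s b :: bool)) = ({a, b} \<notin> G))"
    unfolding order_change_def by blast
  from assms(2) obtain H t where H: "finite H" "card H \<le> l" and Ht: "\<And>a b. a\<in>{1..n} \<Longrightarrow> b\<in>{1..n} \<Longrightarrow> a \<noteq> b \<Longrightarrow>
       ((label_pos ys a < label_pos ys b) = (label_pos zs a < label_pos zs b)) =
       ((t a = (t b :: bool)) = ({a, b} \<notin> H))"
    unfolding order_change_def by blast
  define K where "K = (G - H) \<union> (H - G)"
  have "card K \<le> card (G \<union> H)"
    unfolding K_def using G H by (intro card_mono) auto
  also have "\<dots> \<le> k + l"
    using card_Un_le[of G H] G H by linarith
  finally have "card K \<le> k + l" .
  moreover have "((label_pos xs a < label_pos xs b) = (label_pos zs a < label_pos zs b)) =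
       (((s a = t a) = (s b = t b)) = ({a, b} \<notin> K))"
    if "a \<in> {1..n}" "b \<in> {1..n}" "a \<noteq> b" for a b
    using Gs[OF that] Ht[OF that] unfolding K_def by blast
  moreover have "finite K"
    unfolding K_def using G H by simp
  ultimately show ?thesis
    unfolding order_change_def by (intro exI[of _ K] exI[of _ "\<lambda>a. s a = t a"]) blast
qed

lemma order_changeI_nth:
  assumes xs: "xs \<in> labelings n" and "finite G" "card G \<le> k"
    and "\<And>i j. i < n \<Longrightarrow> j < n \<Longrightarrow> i \<noteq> j \<Longrightarrow>
       ((i < j) = (label_pos ys (xs ! i) < label_pos ys (xs ! j))) =
       ((s (xs ! i) = (s (xs ! j) :: bool)) = ({xs ! i, xs ! j} \<notin> G))"
  shows "order_change n k xs ys"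
  unfolding order_change_def
proof (intro exI[of _ G] exI[of _ s] conjI assms ballI impI)
  fix a b assume "a \<in> {1..n}" "b \<in> {1..n}" "a \<noteq> b"
  moreover obtain i where "i < n" "a = xs ! i" using labeling_nthE[OF xs \<open>a \<in> _\<close>] by metis
  moreover obtain j where "j < n" "b = xs ! j" using labeling_nthE[OF xs \<open>b \<in> _\<close>] by metis
  ultimately show "((label_pos xs a < label_pos xs b) = (label_pos ys a < label_pos ys b)) =
       ((s a = s b) = ({a, b} \<notin> G))"
    using assms(4)[of i j] label_pos_nth[OF xs] by auto
qed

text \<open>The first label jumps to the end and thereby passes every other label, so the cut
  isolates this single label and no pair counts as swapped.\<close>

lemma order_change_rotate1:
  assumes xs: "xs \<in> labelings n"
  shows "order_change n 0 xs (rotate1 xs)"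
proof (rule order_changeI_nth[where G = "{}" and s = "\<lambda>a. a = xs ! 0", OF xs])
  have r: "rotate1 xs \<in> labelings n" using rotate_labeling[OF xs, of 1] by simp
  have pos: "label_pos (rotate1 xs) (xs ! i) = (if i = 0 then n - 1 else i - 1)" if "i < n" for i
  proof -
    let ?l = "if i = 0 then n - 1 else i - 1"
    have "rotate1 xs ! ?l = xs ! i"
      using that length_labeling[OF xs] nth_rotate1[of ?l xs] by auto
    then show ?thesis using label_pos_nth[OF r, of ?l] that by auto
  qed
  fix i j assume "i < n" "j < n" "i \<noteq> j"
  then show "((i < j) = (label_pos (rotate1 xs) (xs ! i) < label_pos (rotate1 xs) (xs ! j))) =
       (((xs ! i = xs ! 0) = (xs ! j = xs ! 0)) = ({xs ! i, xs ! j} \<notin> {}))"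
    using nth_labeling_eq_iff[OF xs, of _ 0] by (auto simp: pos)
qed auto

lemma order_change_rotate:
  assumes "xs \<in> labelings n"
  shows "order_change n 0 xs (rotate k xs)"
proof (induction k)
  case 0
  then show ?case by (simp add: order_change_refl)
next
  case (Suc k)
  then show ?case
    using order_change_trans[OF Suc order_change_rotate1[OF rotate_labeling[OF assms, of k]]] by simp
qed

text \<open>Inside the list only the swapped pair changes its order, and the coloring is constant.
  Across the end (\<open>j = 0\<close>) the first and the last label also pass all labels between
  them, which the cut formed by these two labels accounts for.\<close>

lemma order_change_swap:
  assumes xs: "xs \<in> labelings n" and i: "i < n" and j: "j < n" "i \<noteq> j" "j = (i + 1) mod n"
  shows "order_change n 1 xs (swap_labels xs i j)"
proof (rule order_changeI_nth[where G = "{{xs ! i, xs ! j}}"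
      and s = "\<lambda>a. j = 0 \<and> (a = xs ! i \<or> a = xs ! j)", OF xs])
  let ?ys = "swap_labels xs i j"
  have pos: "label_pos ?ys (xs ! l) = (if l = i then j else if l = j then i else l)" if "l < n" for l
  proof -
    let ?l = "if l = i then j else if l = j then i else l"
    have "?ys ! ?l = xs ! l"
      using that i j(1,2) nth_swap_labels[OF length_labeling[OF xs] i j(1), of ?l] by auto
    then show ?thesis using label_pos_nth[OF swap_labeling[OF xs i j(1)], of ?l] that i j(1) by auto
  qed
  have ij: "j = Suc i \<or> j = 0 \<and> Suc i = n"
    using i j(3) by (cases "Suc i = n") auto
  fix l m assume lm: "l < n" "m < n" "l \<noteq> m"
  then have "{xs ! l, xs ! m} = {xs ! i, xs ! j} \<longleftrightarrow> l = i \<and> m = j \<or> l = j \<and> m = i"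
    using i j(1) by (simp add: doubleton_eq_iff nth_labeling_eq_iff[OF xs])
  then show "((l < m) = (label_pos ?ys (xs ! l) < label_pos ?ys (xs ! m))) =
       (((j = 0 \<and> (xs ! l = xs ! i \<or> xs ! l = xs ! j)) = (j = 0 \<and> (xs ! m = xs ! i \<or> xs ! m = xs ! j)))
        = ({xs ! l, xs ! m} \<notin> {{xs ! i, xs ! j}}))"
    using lm i j(1,2) ij by (auto simp: pos nth_labeling_eq_iff[OF xs])
qed auto

text \<open>The swap may use representatives other than \<open>xs\<close> and \<open>ys\<close>, but
  passing to those is a rotation on either side and costs nothing.\<close>

lemma order_change_adjacent_swap:
  assumes "(P, Q) \<in> adjacent_swap n" "xs \<in> P" "ys \<in> Q"
  shows "order_change n 1 xs ys"
proof -
  from assms(1) obtain zs i j where PQ: "P \<in> cyclic_perms n" "Q \<in> cyclic_perms n"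
    and zs: "zs \<in> P" and ij: "i < n" "j < n" "i \<noteq> j" "j = (i + 1) mod n"
    and sw: "swap_labels zs i j \<in> Q"
    by (auto simp: adjacent_swap_def)
  have xl: "xs \<in> labelings n" and zl: "zs \<in> labelings n" and sl: "swap_labels zs i j \<in> labelings n"
    using assms(2) zs sw PQ cyclic_perm_subset by blast+
  obtain k where "zs = rotate k xs" using cyclic_perm_rotate[OF PQ(1) assms(2) zs] .
  then have 1: "order_change n 0 xs zs" using order_change_rotate[OF xl] by simp
  obtain l where "ys = rotate l (swap_labels zs i j)" using cyclic_perm_rotate[OF PQ(2) sw assms(3)] .
  then have 2: "order_change n 0 (swap_labels zs i j) ys" using order_change_rotate[OF sl] by simp
  show ?thesis
    using order_change_trans[OF order_change_trans[OF 1 order_change_swap[OF zl ij]] 2] by simp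
qed

lemma order_change_relpow:
  assumes "(P, Q) \<in> adjacent_swap n ^^ k" "P \<in> cyclic_perms n" "xs \<in> P" "ys \<in> Q"
  shows "order_change n k xs ys"
  using assms
proof (induction k arbitrary: Q ys)
  case 0
  then have "Q = P" by simp
  then obtain l where "ys = rotate l xs" using cyclic_perm_rotate[of P n xs ys] 0 by blast
  moreover have "xs \<in> labelings n" using 0 cyclic_perm_subset by blast
  ultimately show ?case using order_change_rotate by simp
next
  case (Suc k)
  then obtain R where R: "(P, R) \<in> adjacent_swap n ^^ k" "(R, Q) \<in> adjacent_swap n" by auto
  then obtain zs where zs: "zs \<in> R" by (auto simp: adjacent_swap_def)
  show ?case
    using order_change_trans[OF Suc.IH[OF R(1) Suc.prems(2,3) zs]
        order_change_adjacent_swap[OF R(2) zs Suc.prems(4)]] by simp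
qed

section \<open>Pairs that the reversal forces to be swapped\<close>

lemma two_cliques_ge:
  fixes p q :: nat
  shows "(p + q - 1)\<^sup>2 div 4 \<le> (p choose 2) + (q choose 2)"
proof (cases "p + q = 0")
  case False
  have c: "2 * int (m choose 2) = int m * (int m - 1)" for m :: nat
  proof -
    have "2 * (m choose 2) = m * (m - 1)" unfolding choose_two by (cases m) auto
    then have "int (2 * (m choose 2)) = int (m * (m - 1))" by simp
    then show ?thesis by (cases m) (auto simp: algebra_simps)
  qed
  \<comment> \<open>The deviation from an even split is the square of \<open>p - q\<close>; the
    surplus 1 disappears in the division by 4.\<close>
  have "4 * (int (p choose 2) + int (q choose 2)) + 1
      = (int p + int q - 1)\<^sup>2 + (int p - int q)\<^sup>2"
    using c[of p] c[of q] by (simp add: algebra_simps power2_eq_square)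
  then have "(int p + int q - 1)\<^sup>2 \<le> 4 * (int (p choose 2) + int (q choose 2)) + 1"
    using zero_le_power2[of "int p - int q"] by linarith
  moreover have "int (p + q - 1) = int p + int q - 1" using False by linarith
  ultimately have "int ((p + q - 1)\<^sup>2) \<le> int (4 * ((p choose 2) + (q choose 2)) + 1)" by simp
  then have "(p + q - 1)\<^sup>2 \<le> 4 * ((p choose 2) + (q choose 2)) + 1" by (simp only: of_nat_le_iff)
  then show ?thesis using div_le_mono[of "(p + q - 1)\<^sup>2" _ 4] by fastforce
qed simp

text \<open>Every pair changes its order, so a pair of equally colored labels has to lie in
  \<open>G\<close>. The color classes \<open>S\<close> and \<open>T\<close> therefore span two
  disjoint cliques inside \<open>G\<close>.\<close>

lemma reversal_distance_ge:
  assumes "order_change n k (rev [1..<Suc n]) [1..<Suc n]"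
  shows "(n - 1)\<^sup>2 div 4 \<le> k"
proof -
  from assms obtain G s where G: "finite G" "card G \<le> k" and Gs: "\<And>a b. a\<in>{1..n} \<Longrightarrow> b\<in>{1..n} \<Longrightarrow> a \<noteq> b \<Longrightarrow>
       ((label_pos (rev [1..<Suc n]) a < label_pos (rev [1..<Suc n]) b)
         = (label_pos [1..<Suc n] a < label_pos [1..<Suc n] b)) =
       ((s a = (s b :: bool)) = ({a, b} \<notin> G))"
    unfolding order_change_def by blast
  have pos: "label_pos [1..<Suc n] a = a - 1" if "a \<in> {1..n}" for a
    using label_pos_nth[OF trivial_labeling[of n], of "a - 1"] that by (auto simp del: upt_Suc)
  have rpos: "label_pos (rev [1..<Suc n]) a = n - a" if "a \<in> {1..n}" for a
    using label_pos_nth[OF reversed_labeling[of n], of "n - a"] that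
    by (auto simp del: upt_Suc simp: rev_nth)
  have mono: "{a, b} \<in> G" if "a\<in>{1..n}" "b\<in>{1..n}" "a \<noteq> b" "s a = s b" for a b
    using Gs[OF that(1-3)] that(3,4)
    unfolding pos[OF that(1)] pos[OF that(2)] rpos[OF that(1)] rpos[OF that(2)]
    using that(1,2) by auto
  define S where "S = {a\<in>{1..n}. s a}"
  define T where "T = {a\<in>{1..n}. \<not> s a}"
  have fin: "finite S" "finite T" by (auto simp: S_def T_def)
  define GS where "GS = {e. e \<subseteq> S \<and> card e = 2}"
  define GT where "GT = {e. e \<subseteq> T \<and> card e = 2}"
  have "GS \<union> GT \<subseteq> G"
  proof
    fix e assume e: "e \<in> GS \<union> GT"
    then have "card e = 2" by (auto simp: GS_def GT_def)
    then obtain a b where ab: "e = {a, b}" "a \<noteq> b" by (auto simp: card_2_iff)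
    then show "e \<in> G" using e mono by (auto simp: GS_def GT_def S_def T_def)
  qed
  then have "card (GS \<union> GT) \<le> k" using card_mono[OF G(1)] G(2) le_trans by blast
  moreover have "GS \<inter> GT = {}"
  proof -
    have False if "e \<in> GS" "e \<in> GT" for e
    proof -
      have "e \<subseteq> S \<inter> T" using that by (auto simp: GS_def GT_def)
      then have "e = {}" by (auto simp: S_def T_def)
      then show False using that by (auto simp: GS_def)
    qed
    then show ?thesis by blast
  qed
  moreover have "finite GS" "finite GT" using fin by (auto simp: GS_def GT_def)
  ultimately have "card GS + card GT \<le> k" by (simp add: card_Un_disjoint)
  then have "(card S choose 2) + (card T choose 2) \<le> k"
    using n_subsets[OF fin(1), of 2] n_subsets[OF fin(2), of 2] by (simp add: GS_def GT_def)
  moreover have "card S + card T = n"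
  proof -
    have "S \<union> T = {1..n}" "S \<inter> T = {}" by (auto simp: S_def T_def)
    then show ?thesis using card_Un_disjoint[OF fin] by simp
  qed
  ultimately show ?thesis using two_cliques_ge[of "card S" "card T"] by simp
qed


section \<open>Sorting along a lift to the integers\<close>

text \<open>
  Unrolling the cycle, a label \<open>a\<close> sits at the integers \<open>X a + n\<int>\<close> and has to move to
  \<open>Y a + n\<int>\<close>. The difference of floors is the signed number of times that \<open>a\<close> passes \<open>b\<close>; every
  unordered pair is counted twice.
\<close>

definition crossings :: "nat \<Rightarrow> (nat \<Rightarrow> int) \<Rightarrow> (nat \<Rightarrow> int) \<Rightarrow> nat \<times> nat \<Rightarrow> int" where
  "crossings n X Y = (\<lambda>(a, b). \<bar>(Y a - Y b) div int n - (X a - X b) div int n\<bar>)"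

definition lift_cost :: "nat \<Rightarrow> (nat \<Rightarrow> int) \<Rightarrow> (nat \<Rightarrow> int) \<Rightarrow> int" where
  "lift_cost n X Y = sum (crossings n X Y) ({1..n} \<times> {1..n})"

lemma div_add_one_eq:
  fixes z m :: int
  assumes "m > 0" "\<not> m dvd z + 1"
  shows "(z + 1) div m = z div m"
proof (rule int_div_pos_eq[of _ _ _ "z mod m + 1"])
  show "z + 1 = m * (z div m) + (z mod m + 1)" by simp
  have "z mod m \<noteq> m - 1"
  proof
    assume "z mod m = m - 1"
    then have "z + 1 = m * (z div m + 1)"
      using mult_div_mod_eq[of m z] unfolding distrib_left by linarith
    then show False using assms(2) by simp
  qed
  then show "z mod m + 1 < m" using pos_mod_bound[OF assms(1), of z] by linarith
  show "0 \<le> z mod m + 1" using pos_mod_sign[OF assms(1), of z] by linarith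
qed

text \<open>The label \<open>a\<close> sits directly before the copy of \<open>b\<close> at
  \<open>X b + m * int n\<close>, but its target lies beyond the target of that copy. Exchanging
  them performs one forced crossing, counted once for \<open>(a, b)\<close> and once for
  \<open>(b, a)\<close>.\<close>

lemma lift_cost_descent:
  fixes X Y :: "nat \<Rightarrow> int" and m :: int
  assumes ab: "a \<in> {1..n}" "b \<in> {1..n}" "a \<noteq> b"
    and inj: "\<And>c d. c \<in> {1..n} \<Longrightarrow> d \<in> {1..n} \<Longrightarrow> int n dvd X c - X d \<Longrightarrow> c = d"
    and X: "X a + 1 - X b = m * int n" and Y: "Y b + m * int n < Y a"
  shows "lift_cost n (X(a := X a + 1, b := X b - 1)) Y \<le> lift_cost n X Y - 2"
proof -
  define N where "N = int n"
  have N: "N \<ge> 2" using ab by (auto simp: N_def)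
  let ?X = "X(a := X a + 1, b := X b - 1)"
  have step: "(z + 1) div N = z div N" if "\<not> N dvd z + 1" for z
    using div_add_one_eq[OF _ that] N by simp
  have inj': "\<not> N dvd X c - X d" if "c \<in> {1..n}" "d \<in> {1..n}" "c \<noteq> d" for c d
    using inj[OF that(1,2)] that(3) by (auto simp: N_def)
  have Xb: "X b = X a + 1 - m * N" using X by (simp add: N_def)
  \<comment> \<open>The new place of \<open>a\<close> is congruent to the old place of
    \<open>b\<close>, and vice versa. No third label is met modulo \<open>N\<close>, so the floors
    of its pairs stay.\<close>
  have up: "(X a + 1 - X c) div N = (X a - X c) div N" if "c \<in> {1..n}" "c \<noteq> a" "c \<noteq> b" for c
  proof -
    have "X a + 1 - X c = (X b - X c) + m * N" using Xb by simp
    then have "\<not> N dvd X a + 1 - X c" using inj'[of b c] ab that by (metis dvd_add_times_triv_right_iff)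
    then show ?thesis using step[of "X a - X c"] by (simp add: algebra_simps)
  qed
  have down: "(X c - (X a + 1)) div N = (X c - X a) div N" if "c \<in> {1..n}" "c \<noteq> a" "c \<noteq> b" for c
    using step[of "X c - X a - 1"] inj'[of c a] ab that by (simp add: algebra_simps)
  have upb: "(X c - (X b - 1)) div N = (X c - X b) div N" if "c \<in> {1..n}" "c \<noteq> a" "c \<noteq> b" for c
  proof -
    have "X c - X b + 1 = (X c - X a) + m * N" using Xb by simp
    then have "\<not> N dvd X c - X b + 1" using inj'[of c a] ab that by (metis dvd_add_times_triv_right_iff)
    then show ?thesis using step[of "X c - X b"] by (simp add: algebra_simps)
  qed
  have downb: "(X b - 1 - X c) div N = (X b - X c) div N" if "c \<in> {1..n}" "c \<noteq> a" "c \<noteq> b" for c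
    using step[of "X b - 1 - X c"] inj'[of b c] ab that by (simp add: algebra_simps)
  \<comment> \<open>The floor for \<open>(a, b)\<close> rises from \<open>m - 1\<close> to
    \<open>m\<close>, where the target is at least \<open>m\<close>; the floor for
    \<open>(b, a)\<close> falls from \<open>- m\<close> to \<open>- m - 1\<close>, where the target
    is at most that. Both absolute values drop by one.\<close>
  have "(X a - X b) div N = m - 1"
  proof (rule int_div_pos_eq[of _ _ _ "N - 1"])
    show "X a - X b = N * (m - 1) + (N - 1)" using Xb by (simp add: algebra_simps)
  qed (use N in auto)
  moreover have "(X a + 1 - (X b - 1)) div N = m"
  proof (rule int_div_pos_eq[of _ _ _ 1])
    show "X a + 1 - (X b - 1) = N * m + 1" using Xb by (simp add: algebra_simps)
  qed (use N in auto)
  moreover have "(Y a - Y b) div N \<ge> m"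
    using Y N zdiv_mono1[of "m * N" "Y a - Y b" N] by (simp add: N_def)
  ultimately have cab: "crossings n ?X Y (a, b) = crossings n X Y (a, b) - 1"
    using ab by (simp add: crossings_def flip: N_def)
  have "(X b - X a) div N = - m"
  proof (rule int_div_pos_eq[of _ _ _ 1])
    show "X b - X a = N * (- m) + 1" using Xb by (simp add: algebra_simps)
  qed (use N in auto)
  moreover have "(X b - 1 - (X a + 1)) div N = - m - 1"
  proof (rule int_div_pos_eq[of _ _ _ "N - 1"])
    show "X b - 1 - (X a + 1) = N * (- m - 1) + (N - 1)" using Xb by (simp add: algebra_simps)
  qed (use N in auto)
  moreover have "(Y b - Y a) div N \<le> - m - 1"
  proof -
    have "Y b - Y a < (- m) * N" using Y by (simp add: N_def)
    moreover have "((Y b - Y a) div N) * N \<le> Y b - Y a"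
      using div_mult_mod_eq[of "Y b - Y a" N] pos_mod_sign[of N "Y b - Y a"] N by linarith
    ultimately have "((Y b - Y a) div N) * N < (- m) * N" by linarith
    then have "(Y b - Y a) div N < - m" using N mult_right_less_imp_less by fastforce
    then show ?thesis by simp
  qed
  ultimately have cba: "crossings n ?X Y (b, a) = crossings n X Y (b, a) - 1"
    using ab by (simp add: crossings_def flip: N_def)
  have pt: "crossings n ?X Y e = crossings n X Y e - (if e \<in> {(a, b), (b, a)} then 1 else 0)"
    if "e \<in> {1..n} \<times> {1..n}" for e
  proof (cases "e \<in> {(a, b), (b, a)}")
    case True
    then show ?thesis using cab cba ab by auto
  next
    case False
    obtain c d where e: "e = (c, d)" by (cases e)
    then have cd: "c \<in> {1..n}" "d \<in> {1..n}" "(c, d) \<noteq> (a, b)" "(c, d) \<noteq> (b, a)"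
      using that False by auto
    have "(?X c - ?X d) div N = (X c - X d) div N"
    proof (cases "c = d")
      case False
      then consider "c = a" "d \<noteq> a" "d \<noteq> b" | "c = b" "d \<noteq> a" "d \<noteq> b" | "d = a" "c \<noteq> a" "c \<noteq> b"
        | "d = b" "c \<noteq> a" "c \<noteq> b" | "c \<noteq> a" "c \<noteq> b" "d \<noteq> a" "d \<noteq> b"
        using cd by auto
      then show ?thesis
        using ab cd up[of d] down[of c] upb[of c] downb[of d] by cases auto
    qed simp
    then show ?thesis using False by (simp add: crossings_def e N_def)
  qed
  have "lift_cost n ?X Y
      = lift_cost n X Y - (\<Sum>e\<in>{1..n} \<times> {1..n}. if e \<in> {(a, b), (b, a)} then 1 else 0)"
    unfolding lift_cost_def using pt by (simp add: sum_subtractf)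
  also have "(\<Sum>e\<in>{1..n} \<times> {1..n}. if e \<in> {(a, b), (b, a)} then 1 else 0) = (2::int)"
  proof -
    have "({1..n} \<times> {1..n}) \<inter> {(a, b), (b, a)} = {(a, b), (b, a)}" using ab by auto
    moreover have "card {(a, b), (b, a)} = 2" using ab by simp
    ultimately show ?thesis by (simp add: sum.If_cases Int_def[symmetric] del: insert_iff)
  qed
  finally show ?thesis by (rule eq_refl)
qed

text \<open>Read along the integers: \<open>lab z\<close> is the label at \<open>z\<close> and
  \<open>V z\<close> the target of its copy there. Without adjacent descents \<open>V\<close> is
  monotone, and strictly so because distinct labels have incongruent targets. Over one period it
  gains exactly \<open>N\<close>, so it is a translation.\<close>

lemma sorted_lift_trivial:
  fixes X Y :: "nat \<Rightarrow> int"
  assumes xs: "xs \<in> labelings n" and n: "n \<ge> 1"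
    and X: "\<And>i. i < n \<Longrightarrow> X (xs ! i) mod int n = int i"
    and Y: "\<And>a. a \<in> {1..n} \<Longrightarrow> int n dvd Y a - int a"
    and sorted: "\<And>a b. a \<in> {1..n} \<Longrightarrow> b \<in> {1..n} \<Longrightarrow> int n dvd X a + 1 - X b \<Longrightarrow>
      Y a \<le> Y b + (X a + 1 - X b)"
  shows "rotation_rel n `` {xs} = trivial_cyclic_perm n"
proof -
  define N where "N = int n"
  have N: "N > 0" using n by (simp add: N_def)
  define lab where "lab = (\<lambda>z. xs ! nat (z mod N))"
  have nat_mod: "nat (z mod N) < n" for z
    using pos_mod_bound[OF N, of z] pos_mod_sign[OF N, of z] unfolding N_def by linarith
  have lab: "lab z \<in> {1..n}" for z
    unfolding lab_def using nth_labeling[OF xs nat_mod] .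
  have Xlab: "N dvd z - X (lab z)" for z
  proof -
    have "z mod N = X (lab z) mod N"
      unfolding lab_def using X[OF nat_mod[of z]] pos_mod_sign[OF N, of z] by (simp add: N_def)
    then show ?thesis by (simp only: mod_eq_dvd_iff)
  qed
  define V where "V = (\<lambda>z. Y (lab z) + (z - X (lab z)))"
  have Vmod: "N dvd V z - int (lab z)" for z
    using dvd_add[OF Y[OF lab[of z], folded N_def] Xlab[of z]] by (simp add: V_def algebra_simps)
  have V1: "V z + 1 \<le> V (z + 1)" for z
  proof -
    let ?a = "lab z" and ?b = "lab (z + 1)"
    have "N dvd (z + 1 - X ?b) - (z - X ?a)" by (intro dvd_diff Xlab)
    then have d: "N dvd X ?a + 1 - X ?b" by (simp add: algebra_simps)
    then have le: "V z \<le> V (z + 1)"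
      using sorted[OF lab[of z] lab[of "z + 1"]] by (simp add: V_def N_def)
    have "V z \<noteq> V (z + 1)"
    proof
      assume eq: "V z = V (z + 1)"
      have "N dvd (V z - int ?a) - (V (z + 1) - int ?b)" by (intro dvd_diff Vmod)
      then have "N dvd int ?b - int ?a" using eq by simp
      then have "?b = ?a"
        using lab[of z] lab[of "z + 1"] zdvd_not_zless[of "int ?b - int ?a" N]
          zdvd_not_zless[of "int ?a - int ?b" N] dvd_diff_commute[of N "int ?b" "int ?a"]
        by (force simp: N_def)
      then show False using eq by (simp add: V_def)
    qed
    then show ?thesis using le by simp
  qed
  have Vle: "V z + int k \<le> V (z + int k)" for z k
  proof (induction k)
    case (Suc k)
    then show ?case using V1[of "z + int k"] by (simp add: algebra_simps)
  qed simp
  \<comment> \<open>\<open>N\<close> steps of size at least 1 add up to \<open>N\<close>, so each of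
    them has size exactly 1.\<close>
  have "V N = V 0 + N" by (simp add: V_def lab_def)
  then have Veq: "V (int i) = V 0 + int i" if "i < n" for i
    using Vle[of 0 i] Vle[of "int i" "n - i"] that by (simp add: N_def)
  \<comment> \<open>The subtraction of 1 matches labels starting at 1 with positions starting at
    0.\<close>
  define k where "k = nat ((V 0 - 1) mod N)"
  have k: "int k = (V 0 - 1) mod N" using N by (simp add: k_def)
  have "xs = rotate k [1..<Suc n]"
  proof (rule nth_equalityI)
    show "length xs = length (rotate k [1..<Suc n])" using length_labeling[OF xs] by simp
    fix i assume "i < length xs"
    then have i: "i < n" using length_labeling[OF xs] by simp
    have li: "lab (int i) = xs ! i" using i by (simp add: lab_def N_def)
    have "N dvd V 0 + int i - int (xs ! i)"
      using Vmod[of "int i"] Veq[OF i] li by simp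
    then have "(V 0 + int i - 1) mod N = (int (xs ! i) - 1) mod N"
      by (simp add: mod_eq_dvd_iff algebra_simps)
    also have "\<dots> = int (xs ! i) - 1"
      using nth_labeling[OF xs i] by (intro mod_pos_pos_trivial) (auto simp: N_def)
    also have "(V 0 + int i - 1) mod N = (int k + int i) mod N"
      unfolding k by (simp add: mod_simps algebra_simps)
    finally have "int (xs ! i) = 1 + int ((k + i) mod n)"
      by (simp add: N_def zmod_int)
    then have "xs ! i = 1 + (k + i) mod n" by linarith
    then show "xs ! i = rotate k [1..<Suc n] ! i"
      using i n by (simp add: nth_rotate del: upt_Suc)
  qed
  then have "([1..<Suc n], xs) \<in> rotation_rel n"
    using trivial_labeling[of n] unfolding rotation_rel_def by blast
  then show ?thesis
    unfolding trivial_cyclic_perm_def using equiv_class_eq[OF equiv_rotation_rel] by metis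
qed

section \<open>Sorting by forced crossings\<close>

lemma lift_cost_nonneg: "lift_cost n X Y \<ge> 0"
  unfolding lift_cost_def crossings_def by (intro sum_nonneg) auto

text \<open>While some adjacent pair is in descent, swapping it lowers the cost by at least 2; once
  there is none, the labeling is trivial. The lift agrees with the positions only modulo
  \<open>n\<close>, since a swap across the end may take it out of \<open>{0..<n}\<close>.\<close>

lemma sort_along_lift:
  fixes X Y :: "nat \<Rightarrow> int"
  assumes "xs \<in> labelings n" "n \<ge> 1"
    and "\<And>i. i < n \<Longrightarrow> X (xs ! i) mod int n = int i"
    and "\<And>a. a \<in> {1..n} \<Longrightarrow> int n dvd Y a - int a"
    and "lift_cost n X Y \<le> 2 * int m"
  shows "\<exists>k\<le>m. (rotation_rel n `` {xs}, trivial_cyclic_perm n) \<in> adjacent_swap n ^^ k"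
  using assms
proof (induction m arbitrary: xs X rule: less_induct)
  case (less m)
  note xs = less.prems(1) and n = less.prems(2) and X = less.prems(3) and Y = less.prems(4)
  show ?case
  proof (cases "\<forall>a\<in>{1..n}. \<forall>b\<in>{1..n}. int n dvd X a + 1 - X b \<longrightarrow> Y a \<le> Y b + (X a + 1 - X b)")
    case True
    then have "rotation_rel n `` {xs} = trivial_cyclic_perm n"
      using sorted_lift_trivial[OF xs n X Y] by blast
    then show ?thesis by (intro exI[of _ 0]) simp
  next
    case False
    \<comment> \<open>The copy of \<open>b\<close> immediately after \<open>a\<close> has its target
      before the target of \<open>a\<close>.\<close>
    then obtain a b where ab: "a \<in> {1..n}" "b \<in> {1..n}"
      and d: "int n dvd X a + 1 - X b" and Yab: "Y b + (X a + 1 - X b) < Y a"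
      by force
    have "a \<noteq> b" using Yab by auto
    obtain l where l: "X a + 1 - X b = l * int n" using d by (metis dvdE mult.commute)
    obtain i where i: "i < n" "xs ! i = a" using labeling_nthE[OF xs ab(1)] .
    obtain j where j: "j < n" "xs ! j = b" using labeling_nthE[OF xs ab(2)] .
    have Xa: "X a mod int n = int i" and Xb: "X b mod int n = int j" using X i j by auto
    have "X b mod int n = (X a + 1) mod int n" using d by (metis mod_eq_dvd_iff)
    also have "\<dots> = (int i + 1) mod int n" using Xa by (metis mod_add_left_eq)
    finally have "int j = int ((i + 1) mod n)" using Xb by (simp add: zmod_int add.commute)
    then have ji: "j = (i + 1) mod n" by linarith
    have "i \<noteq> j" using i j \<open>a \<noteq> b\<close> by auto
    have inj: "c = e" if ce: "c \<in> {1..n}" "e \<in> {1..n}" "int n dvd X c - X e" for c e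
    proof -
      obtain p where p: "p < n" "xs ! p = c" using labeling_nthE[OF xs ce(1)] .
      obtain q where q: "q < n" "xs ! q = e" using labeling_nthE[OF xs ce(2)] .
      have "X c mod int n = X e mod int n" using ce(3) by (simp add: mod_eq_dvd_iff)
      then show ?thesis using X[OF p(1)] X[OF q(1)] p q by simp
    qed
    let ?X = "X(a := X a + 1, b := X b - 1)" and ?ys = "swap_labels xs i j"
    have cost: "lift_cost n ?X Y \<le> lift_cost n X Y - 2"
      using lift_cost_descent[where m = l, OF ab \<open>a \<noteq> b\<close> inj l] Yab l by simp
    have "m > 0" using cost lift_cost_nonneg[of n ?X Y] less.prems(5) by linarith
    have ys: "?ys \<in> labelings n" using swap_labeling[OF xs i(1) j(1)] .
    have ysX: "?X (?ys ! p) mod int n = int p" if "p < n" for p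
    proof -
      have nth: "?ys ! p = (if p = j then a else if p = i then b else xs ! p)"
        using nth_swap_labels[OF length_labeling[OF xs] i(1) j(1) that] i j by simp
      have "(X b - 1) mod int n = X a mod int n"
        using d by (simp add: mod_eq_dvd_iff dvd_diff_commute algebra_simps)
      moreover have "(X a + 1) mod int n = X b mod int n"
        using d by (simp add: mod_eq_dvd_iff)
      moreover have "xs ! p \<noteq> a" if "p \<noteq> i"
        using that \<open>p < n\<close> i nth_labeling_eq_iff[OF xs \<open>p < n\<close> i(1)] by simp
      moreover have "xs ! p \<noteq> b" if "p \<noteq> j"
        using that \<open>p < n\<close> j nth_labeling_eq_iff[OF xs \<open>p < n\<close> j(1)] by simp
      ultimately show ?thesis
        unfolding nth using Xa Xb X[OF \<open>p < n\<close>] \<open>a \<noteq> b\<close> by auto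
    qed
    have "lift_cost n ?X Y \<le> 2 * int (m - 1)" using cost less.prems(5) \<open>m > 0\<close> by simp
    then obtain k where k: "k \<le> m - 1"
      "(rotation_rel n `` {?ys}, trivial_cyclic_perm n) \<in> adjacent_swap n ^^ k"
      using less.IH[of "m - 1", where X = ?X, OF _ ys n ysX Y] \<open>m > 0\<close> by (auto simp del: fun_upd_apply)
    have "(rotation_rel n `` {xs}, rotation_rel n `` {?ys}) \<in> adjacent_swap n"
      unfolding adjacent_swap_def
      using rotation_class_in_cyclic_perms[OF xs] rotation_class_in_cyclic_perms[OF ys]
        in_rotation_class[OF xs] in_rotation_class[OF ys] i(1) j(1) \<open>i \<noteq> j\<close> ji by blast
    then have "(rotation_rel n `` {xs}, trivial_cyclic_perm n) \<in> adjacent_swap n ^^ Suc k"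
      using k(2) by (rule relpow_Suc_I2)
    then show ?thesis using k(1) \<open>m > 0\<close> by (intro exI[of _ "Suc k"]) auto
  qed
qed


section \<open>Averaging over the lifts\<close>

text \<open>Induction in steps of 2: the first and the last term are both \<open>n - 2\<close>, and
  the terms between them form the sum for \<open>n - 2\<close> after an index shift.\<close>

lemma sum_abs_double_minus:
  "(\<Sum>k = 1..<n. \<bar>2 * int k - int n\<bar>) = 2 * int ((n - 1)\<^sup>2 div 4)"
proof (induction n rule: less_induct)
  case (less n)
  show ?case
  proof (cases "n \<le> 2")
    case True
    then consider "n = 0" | "n = 1" | "n = 2" by linarith
    then show ?thesis by cases (simp_all add: numeral_2_eq_2)
  next
    case False
    define m where "m = n - 2"
    have m: "m \<ge> 1" and n: "n = Suc (Suc m)" using False by (auto simp: m_def)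
    have "(\<Sum>k = 1..<n. \<bar>2 * int k - int n\<bar>)
        = int m + (\<Sum>k = 2..<Suc (Suc m). \<bar>2 * int k - int n\<bar>)"
      by (subst sum.atLeast_Suc_lessThan) (auto simp: n numeral_2_eq_2)
    also have "(\<Sum>k = 2..<Suc (Suc m). \<bar>2 * int k - int n\<bar>)
        = (\<Sum>k = 1..<Suc m. \<bar>2 * int (Suc k) - int n\<bar>)"
      by (simp only: numeral_2_eq_2 One_nat_def sum.shift_bounds_Suc_ivl)
    also have "\<dots> = (\<Sum>k = 1..<m. \<bar>2 * int k - int m\<bar>) + int m"
      using m by (simp add: n sum.atLeastLessThan_Suc)
    also have "(\<Sum>k = 1..<m. \<bar>2 * int k - int m\<bar>) = 2 * int ((m - 1)\<^sup>2 div 4)"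
      using less.IH[of m] n by simp
    also have "int m + (2 * int ((m - 1)\<^sup>2 div 4) + int m) = 2 * int ((n - 1)\<^sup>2 div 4)"
    proof -
      obtain p where p: "m = Suc p" using m by (cases m) auto
      have "(n - 1)\<^sup>2 = (m - 1)\<^sup>2 + m * 4"
        by (simp add: n p power2_eq_square algebra_simps)
      then show ?thesis by simp
    qed
    finally show ?thesis .
  qed
qed

section \<open>Windows of displacements\<close>

lemma bij_betw_minus_mod:
  fixes u :: int
  assumes "n \<ge> 1"
  shows "bij_betw (\<lambda>t. (u - t) mod int n) {0..<int n} {0..<int n}"
  by (rule bij_betw_byWitness[where f' = "\<lambda>t. (u - t) mod int n"])
    (use assms in \<open>auto simp: mod_simps\<close>)

text \<open>The unique integer congruent to \<open>a\<close> whose displacement from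
  \<open>X a\<close> lies in \<open>{t..<t + n}\<close>.\<close>

definition window_lift :: "nat \<Rightarrow> (nat \<Rightarrow> int) \<Rightarrow> int \<Rightarrow> nat \<Rightarrow> int" where
  "window_lift n X t a = X a + t + (int a - X a - t) mod int n"

text \<open>
  As \<open>t\<close> varies, the number of times that \<open>a\<close> passes \<open>b\<close> keeps its sign, so that the absolute
  values can be pulled out of the sum.
\<close>

lemma sum_crossings_window_lift:
  assumes n: "n \<ge> 1"
  shows "(\<Sum>t\<in>{0..<int n}. crossings n X (window_lift n X t) (a, b))
    = \<bar>(X a - X b) mod int n - (int a - int b) mod int n\<bar>"
proof -
  define N where "N = int n"
  have N: "N > 0" using n by (simp add: N_def)
  define p where "p = (X a - X b) mod N"
  define q where "q = (int a - int b) mod N"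
  define A where "A = (\<lambda>t. (int a - X a - t) mod N)"
  define B where "B = (\<lambda>t. (int b - X b - t) mod N)"
  define c where "c = (\<lambda>t. (window_lift n X t a - window_lift n X t b) div N - (X a - X b) div N)"
  \<comment> \<open>The floors are expressed by their remainders, which are \<open>q\<close> and
    \<open>p\<close> for every \<open>t\<close>.\<close>
  have Nc: "N * c t = A t - B t + (p - q)" for t
  proof -
    have "(window_lift n X t a - window_lift n X t b) mod N
        = ((X a + t + (int a - X a - t)) - (X b + t + (int b - X b - t))) mod N"
      unfolding window_lift_def N_def[symmetric] by (intro mod_diff_cong mod_add_cong) simp_all
    then have "(window_lift n X t a - window_lift n X t b) mod N = q" by (simp add: q_def)
    then show ?thesis
      using mult_div_mod_eq[of N "window_lift n X t a - window_lift n X t b"]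
        mult_div_mod_eq[of N "X a - X b"]
      by (simp add: c_def p_def A_def B_def window_lift_def N_def[symmetric] algebra_simps)
  qed
  \<comment> \<open>Over all \<open>t\<close>, both \<open>A\<close> and \<open>B\<close> run
    through every residue once, so they cancel in the sum of \<open>c\<close>.\<close>
  have "(\<Sum>t\<in>{0..<N}. A t) = (\<Sum>t\<in>{0..<N}. B t)"
    using sum.reindex_bij_betw[OF bij_betw_minus_mod[OF n, of "int a - X a"], of "\<lambda>x. x"]
      sum.reindex_bij_betw[OF bij_betw_minus_mod[OF n, of "int b - X b"], of "\<lambda>x. x"]
    by (simp add: A_def B_def N_def)
  then have "N * (\<Sum>t\<in>{0..<N}. c t) = N * (p - q)"
    using N by (simp add: sum_distrib_left Nc sum.distrib sum_subtractf)
  then have sc: "(\<Sum>t\<in>{0..<N}. c t) = p - q" using N by simp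
  have bounds: "0 \<le> A t" "A t < N" "0 \<le> B t" "B t < N" for t
    using N by (auto simp: A_def B_def)
  have "(\<Sum>t\<in>{0..<N}. \<bar>c t\<bar>) = \<bar>p - q\<bar>"
  proof (cases "q \<le> p")
    case True
    \<comment> \<open>Two residues differ by less than \<open>N\<close>, so for nonnegative
      \<open>p - q\<close> the multiple \<open>N * c t\<close> stays above
      \<open>- N\<close>.\<close>
    have "c t \<ge> 0" for t
    proof -
      have "N * (-1) < N * c t" using Nc[of t] bounds[of t] True by simp
      then have "-1 < c t" using N using mult_less_cancel_left_pos by blast
      then show ?thesis by simp
    qed
    then show ?thesis using sc True by simp
  next
    case False
    have "c t \<le> 0" for t
    proof -
      have "N * c t < N * 1" using Nc[of t] bounds[of t] False by simp
      then have "c t < 1" using N using mult_less_cancel_left_pos by blast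
      then show ?thesis by simp
    qed
    then have "(\<Sum>t\<in>{0..<N}. \<bar>c t\<bar>) = (\<Sum>t\<in>{0..<N}. - c t)" by (intro sum.cong) auto
    then show ?thesis using sc False by (simp add: sum_negf)
  qed
  then show ?thesis by (simp add: crossings_def c_def p_def q_def N_def)
qed

text \<open>Measuring both residues from the midpoint \<open>n / 2\<close> decouples
  \<open>p\<close> from \<open>q\<close>; either part is then the same sum over
  \<open>1, ..., n - 1\<close>.\<close>

lemma sum_residue_differences_le:
  fixes p q :: "'a \<Rightarrow> int"
  assumes "bij_betw p B {1..<int n}" "bij_betw q B {1..<int n}"
  shows "(\<Sum>b\<in>B. \<bar>p b - q b\<bar>) \<le> 2 * int ((n - 1)\<^sup>2 div 4)"
proof -
  have eq: "(\<Sum>b\<in>B. \<bar>2 * r b - int n\<bar>) = 2 * int ((n - 1)\<^sup>2 div 4)"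
    if "bij_betw r B {1..<int n}" for r
  proof -
    have "(\<Sum>b\<in>B. \<bar>2 * r b - int n\<bar>) = (\<Sum>k\<in>{1..<int n}. \<bar>2 * k - int n\<bar>)"
      using sum.reindex_bij_betw[OF that, of "\<lambda>k. \<bar>2 * k - int n\<bar>"] .
    also have "{1..<int n} = int ` {1..<n}"
      by (simp add: image_int_atLeastLessThan)
    also have "(\<Sum>k\<in>int ` {1..<n}. \<bar>2 * k - int n\<bar>) = (\<Sum>k = 1..<n. \<bar>2 * int k - int n\<bar>)"
      by (simp add: sum.reindex)
    finally show ?thesis using sum_abs_double_minus by simp
  qed
  have "2 * (\<Sum>b\<in>B. \<bar>p b - q b\<bar>) \<le> (\<Sum>b\<in>B. \<bar>2 * p b - int n\<bar> + \<bar>2 * q b - int n\<bar>)"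
    unfolding sum_distrib_left
  proof (rule sum_mono)
    show "2 * \<bar>p b - q b\<bar> \<le> \<bar>2 * p b - int n\<bar> + \<bar>2 * q b - int n\<bar>" for b
      by arith
  qed
  then show ?thesis by (simp add: sum.distrib eq assms)
qed

lemma bij_betw_diff_mod:
  fixes X :: "nat \<Rightarrow> int"
  assumes a: "a \<in> {1..n}"
    and inj: "\<And>c d. c \<in> {1..n} \<Longrightarrow> d \<in> {1..n} \<Longrightarrow> int n dvd X c - X d \<Longrightarrow> c = d"
  shows "bij_betw (\<lambda>b. (X a - X b) mod int n) ({1..n} - {a}) {1..<int n}"
proof -
  let ?f = "\<lambda>b. (X a - X b) mod int n"
  have n: "int n > 0" using a by auto
  have i: "inj_on ?f ({1..n} - {a})"
  proof (rule inj_onI)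
    fix c d assume cd: "c \<in> {1..n} - {a}" "d \<in> {1..n} - {a}" "?f c = ?f d"
    then have "int n dvd (X a - X c) - (X a - X d)" by (simp only: mod_eq_dvd_iff)
    then have "int n dvd X d - X c" by (simp add: algebra_simps)
    then show "c = d" using inj[of d c] cd by auto
  qed
  have sub: "?f ` ({1..n} - {a}) \<subseteq> {1..<int n}"
  proof
    fix z assume "z \<in> ?f ` ({1..n} - {a})"
    then obtain b where b: "b \<in> {1..n}" "b \<noteq> a" "z = ?f b" by blast
    then have "z \<noteq> 0" using inj[OF a b(1)] by auto
    then show "z \<in> {1..<int n}" using b(3) pos_mod_bound[OF n] pos_mod_sign[OF n, of "X a - X b"] by auto
  qed
  have "card (?f ` ({1..n} - {a})) = card {1..<int n}"
    using card_image[OF i] a by simp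
  then have "?f ` ({1..n} - {a}) = {1..<int n}" using card_subset_eq[OF _ sub] by simp
  then show ?thesis using i by (simp add: bij_betw_def)
qed

text \<open>If all \<open>n\<close> windows were too expensive, their total would exceed
  \<open>n\<close> times the bound. Summed over \<open>t\<close> first, each of the \<open>n\<close>
  labels \<open>a\<close> contributes at most the bound, which is a contradiction.\<close>

lemma exists_cheap_window_lift:
  assumes n: "n \<ge> 1"
    and inj: "\<And>c d. c \<in> {1..n} \<Longrightarrow> d \<in> {1..n} \<Longrightarrow> int n dvd X c - X d \<Longrightarrow> c = d"
  shows "\<exists>t. lift_cost n X (window_lift n X t) \<le> 2 * int ((n - 1)\<^sup>2 div 4)"
proof (rule ccontr)
  let ?F = "2 * int ((n - 1)\<^sup>2 div 4)"
  assume "\<not> ?thesis"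
  then have "(\<Sum>t\<in>{0..<int n}. ?F) < (\<Sum>t\<in>{0..<int n}. lift_cost n X (window_lift n X t))"
    using n by (intro sum_strict_mono) (auto simp: not_le)
  also have "\<dots> = (\<Sum>(a, b)\<in>{1..n} \<times> {1..n}.
      \<bar>(X a - X b) mod int n - (int a - int b) mod int n\<bar>)"
    unfolding lift_cost_def
    by (subst sum.swap) (auto intro!: sum.cong simp: sum_crossings_window_lift[OF n])
  also have "\<dots> = (\<Sum>a\<in>{1..n}. \<Sum>b\<in>{1..n}.
      \<bar>(X a - X b) mod int n - (int a - int b) mod int n\<bar>)"
    by (simp add: sum.cartesian_product)
  also have "\<dots> \<le> (\<Sum>a\<in>{1..n}. ?F)"
  proof (rule sum_mono)
    fix a assume a: "a \<in> {1..n}"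
    have inj': "c = d" if "c \<in> {1..n}" "d \<in> {1..n}" "int n dvd int c - int d" for c d
      using that zdvd_not_zless[of "int c - int d" "int n"]
        zdvd_not_zless[of "int d - int c" "int n"] dvd_diff_commute[of "int n" "int c" "int d"]
      by force
    \<comment> \<open>The diagonal term is zero; without it both residues run exactly through
      \<open>1, ..., n - 1\<close>.\<close>
    have "(\<Sum>b\<in>{1..n}. \<bar>(X a - X b) mod int n - (int a - int b) mod int n\<bar>)
      = (\<Sum>b\<in>{1..n} - {a}. \<bar>(X a - X b) mod int n - (int a - int b) mod int n\<bar>)"
      using a by (subst sum.remove[of _ a]) auto
    also have "\<dots> \<le> ?F"
      by (rule sum_residue_differences_le[OF bij_betw_diff_mod[OF a inj] bij_betw_diff_mod[OF a inj']])
    finally show "(\<Sum>b\<in>{1..n}. \<bar>(X a - X b) mod int n - (int a - int b) mod int n\<bar>) \<le> ?F" .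
  qed
  finally show False by simp
qed

lemma swaps_to_trivial_le:
  assumes n: "n \<ge> 1" and xs: "xs \<in> labelings n"
  shows "\<exists>k\<le>(n - 1)\<^sup>2 div 4. (rotation_rel n `` {xs}, trivial_cyclic_perm n) \<in> adjacent_swap n ^^ k"
proof -
  \<comment> \<open>The positions themselves serve as the initial lift.\<close>
  define X where "X = (\<lambda>a. int (label_pos xs a))"
  have X: "X (xs ! i) = int i" if "i < n" for i
    using label_pos_nth[OF xs that] by (simp add: X_def)
  have "c = d" if cd: "c \<in> {1..n}" "d \<in> {1..n}" "int n dvd X c - X d" for c d
  proof -
    obtain p where p: "p < n" "xs ! p = c" using labeling_nthE[OF xs cd(1)] .
    obtain q where q: "q < n" "xs ! q = d" using labeling_nthE[OF xs cd(2)] .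
    have "X c mod int n = X d mod int n" using cd(3) by (simp add: mod_eq_dvd_iff)
    then show ?thesis using X[OF p(1)] X[OF q(1)] p q by simp
  qed
  then obtain t where t: "lift_cost n X (window_lift n X t) \<le> 2 * int ((n - 1)\<^sup>2 div 4)"
    using exists_cheap_window_lift[OF n] by blast
  have Y: "int n dvd window_lift n X t a - int a" for a
  proof -
    have "int n dvd (int a - X a - t) mod int n - (int a - X a - t)"
      by (metis mod_eq_dvd_iff mod_mod_trivial)
    then show ?thesis by (simp add: window_lift_def algebra_simps)
  qed
  show ?thesis by (rule sort_along_lift[OF xs n _ Y t]) (simp add: X)
qed

section \<open>The maximal distance, attained by the reversal\<close>

theorem theorem1p1:
  fixes n :: nat
  assumes "n \<ge> 1"
  shows "max_swap_distance n = enat (nat \<lfloor>(real n - 1)\<^sup>2 / 4\<rfloor>)"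
proof -
  let ?F = "(n - 1)\<^sup>2 div 4"
  let ?u = "trivial_cyclic_perm n" and ?r = "rotation_rel n `` {rev [1..<Suc n]}"
  have upper: "swap_distance n P ?u \<le> enat ?F" if P: "P \<in> cyclic_perms n" for P
  proof -
    obtain xs where xs: "xs \<in> labelings n" "P = rotation_rel n `` {xs}"
      using P unfolding cyclic_perms_def by (auto elim: quotientE)
    then obtain k where "k \<le> ?F" "(P, ?u) \<in> adjacent_swap n ^^ k"
      using swaps_to_trivial_le[OF assms xs(1)] by blast
    then show ?thesis unfolding swap_distance_def by (intro INF_lower2[of k]) auto
  qed
  have r: "?r \<in> cyclic_perms n"
    by (rule rotation_class_in_cyclic_perms[OF reversed_labeling])
  have "[1..<Suc n] \<in> ?u"
    unfolding trivial_cyclic_perm_def by (rule in_rotation_class[OF trivial_labeling])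
  then have "?F \<le> k" if "(?r, ?u) \<in> adjacent_swap n ^^ k" for k
    using reversal_distance_ge[OF order_change_relpow[OF that r in_rotation_class[OF reversed_labeling]]]
    by blast
  then have "swap_distance n ?r ?u = enat ?F"
    using upper[OF r] unfolding swap_distance_def by (intro antisym INF_greatest) auto
  moreover have "finite (cyclic_perms n)"
    unfolding cyclic_perms_def using finite_labelings equiv_rotation_rel
    by (intro finite_quotient) (auto simp: equiv_def)
  ultimately have "max_swap_distance n = enat ?F"
    unfolding max_swap_distance_def using upper r by (intro Max_eqI) (auto intro: rev_image_eqI)
  \<comment> \<open>Real and truncated subtraction agree because \<open>n\<close> is at least 1, and
    the floor of a quotient of naturals is \<open>div\<close>.\<close>
  moreover have "\<lfloor>(real n - 1)\<^sup>2 / 4\<rfloor> = int ?F"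
  proof -
    have "(real n - 1)\<^sup>2 / 4 = real ((n - 1)\<^sup>2) / real 4"
      using assms by (simp add: of_nat_diff)
    then show ?thesis by (simp only: floor_divide_of_nat_eq)
  qed
  ultimately show ?thesis by simp
qed

end
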